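(* Let $d>1$ be an integer, let $A=M_d(\mathbb{C})$ be the $C^*$-algebra of all $d\times d$ complex matrices, and let $\mathcal{H}$ be a Hilbert $C^*$-module over $A$ with generalized inner product $[\cdot,\cdot]$. Let $T:\mathcal{H}\to\mathcal{H}$ be a function (no linearity, continuity, injectivity or surjectivity is assumed) such that $$|[Tf,Tf']|=|[f,f']|\qquad (f,f'\in\mathcal{H}).$$ Then there exist an $A$-isometry $U:\mathcal{H}\to\mathcal{H}$ and a phase-function $\varphi:\mathcal{H}\to\mathbb{C}$ such that $$Tf=\varphi(f)\,Uf\qquad (f\in\mathcal{H}).$$
   Context: A Hilbert $C^*$-module over a $C^*$-algebra $A$ is here a left $A$-module $\mathcal{H}$ (with compatible complex vector space structure) together with a map $[\cdot,\cdot]:\mathcal{H}\times\mathcal{H}\to A$, the generalized inner product, satisfying for all $f,g,h\in\mathcal{H}$ and $a\in A$: (i) $[f+g,h]=[f,h]+[g,h]$; (ii) $[af,g]=a[f,g]$; (iii) $[g,f]=[f,g]^*$; (iv) $[f,f]\ge 0$, and $[f,f]=0$ if and only if $f=0$; and such that $\mathcal{H}$ is complete with respect to the norm $f\mapsto\|[f,f]\|^{1/2}$. For $a\in A$, $|a|$ denotes the (positive) square root of $a^*a$. An $A$-isometry is a linear map $U:\mathcal{H}\to\mathcal{H}$ with $U(af)=a\,Uf$ and $[Uf,Uf']=[f,f']$ for all $a\in A$ and $f,f'\in\mathcal{H}$. A phase-function is a function $\varphi:\mathcal{H}\to\mathbb{C}$ all of whose values have modulus $1$. *)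

theory Defs
  imports "HOL-Analysis.Analysis"
begin

text \<open>
  The algebra \<open>M\<^sub>d(\<complex>)\<close> is the type \<open>complex ^ 'n ^ 'n\<close> with \<open>d = CARD('n)\<close> and product \<open>**\<close>.
  The type class norm on this type is not the C*-norm; the C*-norm is \<open>cstar_norm\<close> below.
\<close>

definition madj :: "complex ^ 'n ^ 'n \<Rightarrow> complex ^ 'n ^ 'n" where
  "madj a = (\<chi> i j. cnj (a $ j $ i))"

definition mscale :: "complex \<Rightarrow> complex ^ 'n ^ 'n \<Rightarrow> complex ^ 'n ^ 'n" where
  "mscale c a = (\<chi> i j. c * a $ i $ j)"

definition cstar_norm :: "complex ^ 'n ^ 'n \<Rightarrow> real" where
  "cstar_norm a = onorm (\<lambda>x. a *v x)"

definition mpos :: "complex ^ 'n ^ 'n \<Rightarrow> bool" where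
  "mpos a \<longleftrightarrow> madj a = a \<and> (\<forall>x. (\<Sum>i\<in>UNIV. cnj (x $ i) * (a *v x) $ i) \<in> \<real>\<^sub>\<ge>\<^sub>0)"

definition mabs :: "complex ^ 'n ^ 'n \<Rightarrow> complex ^ 'n ^ 'n" where
  "mabs a = (THE b. mpos b \<and> b ** b = madj a ** a)"

definition module_norm :: "('h \<Rightarrow> 'h \<Rightarrow> complex ^ 'n ^ 'n) \<Rightarrow> 'h \<Rightarrow> real" where
  "module_norm ip f = sqrt (cstar_norm (ip f f))"

text \<open>
  The library's \<^locale>\<open>module\<close> requires a commutative ring of scalars, so the axioms of
  a left module over the matrix algebra are listed explicitly.
\<close>

locale hilbert_cstar_module = vector_space cscale
  for cscale :: "complex \<Rightarrow> 'h::ab_group_add \<Rightarrow> 'h" +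
  fixes act :: "complex ^ 'n ^ 'n \<Rightarrow> 'h \<Rightarrow> 'h"
    and ip :: "'h \<Rightarrow> 'h \<Rightarrow> complex ^ 'n ^ 'n"
  assumes act_add_right: "act a (f + g) = act a f + act a g"
    and act_add_left: "act (a + b) f = act a f + act b f"
    and act_mult: "act (a ** b) f = act a (act b f)"
    and act_one: "act (mat 1) f = f"
    and act_mscale: "act (mscale c a) f = cscale c (act a f)"
    and act_cscale: "act a (cscale c f) = cscale c (act a f)"
    and ip_add_left: "ip (f + g) h = ip f h + ip g h"
    and ip_act_left: "ip (act a f) g = a ** ip f g"
    and ip_adj: "ip g f = madj (ip f g)"
    and ip_pos: "mpos (ip f f)"
    and ip_eq_0_iff: "ip f f = 0 \<longleftrightarrow> f = 0"
    and complete: "Metric_space.mcomplete UNIV (\<lambda>f g. module_norm ip (f - g))"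

definition A_isometry ::
  "(complex \<Rightarrow> 'h::ab_group_add \<Rightarrow> 'h) \<Rightarrow> (complex ^ 'n ^ 'n \<Rightarrow> 'h \<Rightarrow> 'h) \<Rightarrow>
   ('h \<Rightarrow> 'h \<Rightarrow> complex ^ 'n ^ 'n) \<Rightarrow> ('h \<Rightarrow> 'h) \<Rightarrow> bool" where
  "A_isometry cscale act ip U \<longleftrightarrow>
     Vector_Spaces.linear cscale cscale U \<and>
     (\<forall>a f. U (act a f) = act a (U f)) \<and>
     (\<forall>f f'. ip (U f) (U f') = ip f f')"

definition phase_function :: "('h \<Rightarrow> complex) \<Rightarrow> bool" where
  "phase_function \<phi> \<longleftrightarrow> (\<forall>f. cmod (\<phi> f) = 1)"

end

theory Submission imports Defs begin

text \<open>
  Fix an index \<open>r\<close> and write \<open>E\<^sub>i\<^sub>j\<close> for the matrix units (\<open>munit i j\<close>). Since \<open>f = \<Sum>\<^sub>i E\<^sub>i\<^sub>r (E\<^sub>r\<^sub>i f)\<close>,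
  the module consists of \<open>d\<close>-tuples of vectors of the corner \<open>K = E\<^sub>r\<^sub>r H\<close>, on which the inner
  product has only the \<open>(r, r)\<close> entry, so that \<open>K\<close> is an ordinary complex inner product space.
  The \<open>A\<close>-isometries of the module are exactly the linear isometries of \<open>K\<close> applied to every
  component. The theorem is therefore a statement of Wigner type for \<open>K\<close>, but an easier
  one: having \<open>d > 1\<close> components makes the antilinear alternative impossible and gives linearity on
  two-dimensional subspaces at once.

  Taking \<open>f = f'\<close> and using that a positive square root is unique, \<open>[Tf, Tf] = [f, f]\<close>. For \<open>k \<in> K\<close>
  the matrix \<open>[k, f]\<close> vanishes outside row \<open>r\<close>, and such a matrix is determined by its absolute value
  up to a scalar of modulus one. Hence \<open>[Tf, Tk] = c [f, k]\<close> with \<open>\<bar>c\<bar> = 1\<close> (\<open>ip_T_corner\<close>). If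
  moreover \<open>k = a f\<close>, then \<open>[a (Tf), Tk] = c [k, k]\<close> is an equality case of
  the Cauchy--Schwarz inequality, so \<open>T (a f)\<close> and \<open>a (Tf)\<close> differ by a phase (\<open>T_act_corner\<close>).

  If \<open>f\<close> has two vectors \<open>k, l \<in> K\<close> as components, then the second fact says that, up to
  phases, \<open>T\<close> is linear on the span of \<open>k\<close> and \<open>l\<close>, and the first one allows the phases to
  be normalized by \<open>[w, Te] = [q, e]\<close> for one fixed \<open>e \<noteq> 0\<close> in \<open>K\<close> (\<open>lifts_pair\<close>). This
  normalization determines the lift \<open>w\<close> of \<open>q\<close> whenever \<open>[q, e] \<noteq> 0\<close>; vectors orthogonal to \<open>e\<close>
  are first moved by a multiple of \<open>e\<close>. The lifts fit together to a linear isometry \<open>V\<close> of \<open>K\<close>, and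
  \<open>U\<close> is \<open>V\<close> applied componentwise. The components of \<open>Tf\<close> are unimodular multiples of those of
  \<open>Uf\<close>; testing two of them against a vector of \<open>K\<close> that is orthogonal to neither shows that the
  multiples agree (\<open>T_eq_U\<close>).
\<close>

section \<open>Matrix units\<close>

definition munit :: "'n \<Rightarrow> 'n \<Rightarrow> complex ^ 'n ^ 'n" where
  "munit i j = (\<chi> a b. if a = i \<and> b = j then 1 else 0)"

lemma madj_nth [simp]: "madj a $ i $ j = cnj (a $ j $ i)"
  by (simp add: madj_def)

lemma mscale_nth [simp]: "mscale c a $ i $ j = c * a $ i $ j"
  by (simp add: mscale_def)

lemma matrix_mult_nth: "(a ** b) $ i $ j = (\<Sum>k\<in>UNIV. a $ i $ k * b $ k $ j)"
  by (simp add: matrix_matrix_mult_def)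

interpretation mscale: vector_space mscale
  by unfold_locales (simp_all add: vec_eq_iff algebra_simps)

lemma mscale_mult_left: "mscale c a ** b = mscale c (a ** b)"
  by (simp add: vec_eq_iff matrix_mult_nth sum_distrib_left mult.assoc)

lemma mscale_mult_right: "a ** mscale c b = mscale c (a ** b)"
  by (simp add: vec_eq_iff matrix_mult_nth sum_distrib_left mult_ac)

lemma mult_diff_left: "(a - b) ** c = a ** c - b ** c" for a b c :: "complex ^ 'n ^ 'n"
  by (simp add: vec_eq_iff matrix_mult_nth sum_subtractf algebra_simps)

lemma mult_diff_right: "a ** (b - c) = a ** b - a ** c" for a b c :: "complex ^ 'n ^ 'n"
  by (simp add: vec_eq_iff matrix_mult_nth sum_subtractf algebra_simps)

lemma madj_madj [simp]: "madj (madj a) = a"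
  by (simp add: vec_eq_iff)

lemma madj_mult: "madj (a ** b) = madj b ** madj a"
  by (simp add: vec_eq_iff matrix_mult_nth mult_ac)

lemma madj_add: "madj (a + b) = madj a + madj b"
  by (simp add: vec_eq_iff)

lemma madj_mscale: "madj (mscale c a) = mscale (cnj c) (madj a)"
  by (simp add: vec_eq_iff)

lemma munit_mult_nth: "(munit i j ** a) $ k $ l = (if k = i then a $ j $ l else 0)"
proof -
  have "(munit i j ** a) $ k $ l = (\<Sum>m\<in>UNIV. if m = j then (if k = i then a $ j $ l else 0) else 0)"
    unfolding matrix_mult_nth by (rule sum.cong) (auto simp: munit_def)
  then show ?thesis by simp
qed

lemma mult_munit_nth: "(a ** munit i j) $ k $ l = (if l = j then a $ k $ i else 0)"
proof -
  have "(a ** munit i j) $ k $ l = (\<Sum>m\<in>UNIV. if m = i then (if l = j then a $ k $ i else 0) else 0)"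
    unfolding matrix_mult_nth by (rule sum.cong) (auto simp: munit_def)
  then show ?thesis by simp
qed

lemma munit_nth: "munit i j $ k $ l = (if k = i \<and> l = j then 1 else 0)"
  by (simp add: munit_def)

lemma munit_mult_munit: "munit i j ** munit k l = (if j = k then munit i l else 0)"
  by (simp add: vec_eq_iff munit_mult_nth munit_nth)

lemma madj_munit [simp]: "madj (munit i j) = munit j i"
  by (auto simp: vec_eq_iff munit_nth)

lemma munit_mult_expand: "munit r i ** a = (\<Sum>j\<in>UNIV. mscale (a $ i $ j) (munit r j))"
proof -
  have "(\<Sum>j\<in>UNIV. mscale (a $ i $ j) (munit r j)) $ k $ l = (munit r i ** a) $ k $ l" for k l
  proof -
    have "(\<Sum>j\<in>UNIV. mscale (a $ i $ j) (munit r j)) $ k $ l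
        = (\<Sum>j\<in>UNIV. if j = l then (if k = r then a $ i $ l else 0) else 0)"
      unfolding sum_component by (rule sum.cong) (auto simp: munit_nth)
    then show ?thesis by (simp add: munit_mult_nth)
  qed
  then show ?thesis by (simp add: vec_eq_iff)
qed

lemma mult_munit_expand: "a ** munit j r = (\<Sum>i\<in>UNIV. mscale (a $ i $ j) (munit i r))"
proof -
  have "(\<Sum>i\<in>UNIV. mscale (a $ i $ j) (munit i r)) $ k $ l = (a ** munit j r) $ k $ l" for k l
  proof -
    have "(\<Sum>i\<in>UNIV. mscale (a $ i $ j) (munit i r)) $ k $ l
        = (\<Sum>i\<in>UNIV. if i = k then (if l = r then a $ k $ j else 0) else 0)"
      unfolding sum_component by (rule sum.cong) (auto simp: munit_nth)
    then show ?thesis by (simp add: mult_munit_nth)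
  qed
  then show ?thesis by (simp add: vec_eq_iff)
qed

lemma sum_munit: "(\<Sum>i\<in>UNIV. munit i i) = (mat 1 :: complex ^ 'n ^ 'n)"
proof -
  have "(\<Sum>i\<in>UNIV. munit i i) $ k $ l = (mat 1 :: complex ^ 'n ^ 'n) $ k $ l" for k l
  proof -
    have "(\<Sum>i\<in>UNIV. munit i i) $ k $ l = (\<Sum>i\<in>UNIV. if i = k then (if l = k then 1 else 0) else (0::complex))"
      unfolding sum_component by (rule sum.cong) (auto simp: munit_nth)
    then show ?thesis by (simp add: mat_def)
  qed
  then show ?thesis by (simp add: vec_eq_iff)
qed

section \<open>Positive square roots\<close>

definition cinner :: "complex ^ 'n \<Rightarrow> complex ^ 'n \<Rightarrow> complex" where
  "cinner x y = (\<Sum>i\<in>UNIV. cnj (x $ i) * y $ i)"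

lemma of_real_cmod_square: "(complex_of_real (cmod z))\<^sup>2 = z * cnj z"
  by (simp add: complex_norm_square flip: of_real_power)

lemma cinner_add_left: "cinner (x + y) z = cinner x z + cinner y z"
  by (simp add: cinner_def algebra_simps sum.distrib)

lemma cinner_add_right: "cinner x (y + z) = cinner x y + cinner x z"
  by (simp add: cinner_def algebra_simps sum.distrib)

lemma cinner_scale_left: "cinner (c *s x) y = cnj c * cinner x y"
  by (simp add: cinner_def sum_distrib_left mult.assoc)

lemma cinner_scale_right: "cinner x (c *s y) = c * cinner x y"
  by (simp add: cinner_def sum_distrib_left mult_ac)

lemma cinner_self: "cinner x x = of_real (\<Sum>i\<in>UNIV. (cmod (x $ i))\<^sup>2)"
  by (simp add: cinner_def of_real_cmod_square mult.commute)

lemma cinner_self_eq_0: "cinner x x = 0 \<longleftrightarrow> x = 0"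
  by (simp add: cinner_self sum_nonneg_eq_0_iff vec_eq_iff del: of_real_sum)

lemma cinner_mult_right: "cinner x (a *v y) = cinner (madj a *v x) y"
proof -
  have "cinner x (a *v y) = (\<Sum>i\<in>UNIV. \<Sum>j\<in>UNIV. cnj (x $ i) * (a $ i $ j * y $ j))"
    by (simp add: cinner_def matrix_vector_mult_def sum_distrib_left)
  also have "\<dots> = (\<Sum>j\<in>UNIV. \<Sum>i\<in>UNIV. cnj (x $ i) * (a $ i $ j * y $ j))"
    by (rule sum.swap)
  also have "\<dots> = cinner (madj a *v x) y"
    by (simp add: cinner_def matrix_vector_mult_def sum_distrib_left sum_distrib_right mult_ac)
  finally show ?thesis .
qed

lemma cinner_axis_left: "cinner (axis k 1) y = y $ k"
proof -
  have "cinner (axis k 1) y = (\<Sum>i\<in>UNIV. if i = k then y $ k else 0)"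
    unfolding cinner_def by (rule sum.cong) (auto simp: axis_def)
  then show ?thesis by simp
qed

lemma mult_axis_nth: "(a *v axis k 1) $ i = a $ i $ k" for a :: "complex ^ 'n ^ 'm"
proof -
  have "(a *v axis k 1) $ i = (\<Sum>j\<in>UNIV. if j = k then a $ i $ k else 0)"
    unfolding matrix_vector_mult_def vec_lambda_beta by (rule sum.cong) (auto simp: axis_def)
  then show ?thesis by simp
qed

lemma mpos_iff: "mpos a \<longleftrightarrow> madj a = a \<and> (\<forall>x. cinner x (a *v x) \<in> \<real>\<^sub>\<ge>\<^sub>0)"
  by (simp add: mpos_def cinner_def)

lemma nonneg_Reals_cinner:
  assumes "mpos a"
  obtains s where "0 \<le> s" "cinner x (a *v x) = complex_of_real s"
proof -
  have "cinner x (a *v x) \<in> \<real>\<^sub>\<ge>\<^sub>0" using assms by (simp only: mpos_iff)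
  then show ?thesis using that by (rule nonneg_Reals_cases) simp
qed

text \<open>
  The quadratic form of \<open>a\<close> is minimal at \<open>x\<close>, so its derivative there in the direction \<open>a x\<close> vanishes;
  this derivative is twice the squared length of \<open>a x\<close>.
\<close>

lemma mpos_kernel:
  assumes "mpos a" and "cinner x (a *v x) = 0"
  shows "a *v x = 0"
proof (rule ccontr)
  assume "a *v x \<noteq> 0"
  define z where "z = a *v x"
  have adj: "madj a = a" using assms(1) by (simp add: mpos_def)
  define N where "N = (\<Sum>i\<in>UNIV. (cmod (z $ i))\<^sup>2)"
  have N: "cinner z z = of_real N"
    by (simp add: N_def cinner_self)
  have "N \<noteq> 0" using \<open>a *v x \<noteq> 0\<close> N cinner_self_eq_0[of z] by (auto simp: z_def)
  then have "N > 0" by (simp add: N_def sum_nonneg order_less_le)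
  obtain q where q: "0 \<le> q" "cinner z (a *v z) = of_real q"
    using nonneg_Reals_cinner[OF assms(1)] by blast
  \<comment> \<open>Along the line \<open>x - s z\<close> the form is \<open>s (s q - 2 N)\<close>, negative for small \<open>s > 0\<close>.\<close>
  define s where "s = N / (q + 1)"
  have s: "s > 0" "s * q < 2 * N"
    using \<open>N > 0\<close> q(1) by (auto simp: s_def field_simps mult_pos_pos add_nonneg_pos)
  define y where "y = x + complex_of_real (- s) *s z"
  have "cinner x (a *v z) = of_real N" 
    unfolding cinner_mult_right adj using N by (simp add: z_def)
  then have "cinner y (a *v y) = of_real (s * (s * q - 2 * N))"
    using assms(2) N q(2)
    by (simp add: y_def matrix_vector_right_distrib vector_scalar_commute cinner_add_left cinner_add_right
        cinner_scale_left cinner_scale_right z_def[symmetric] algebra_simps del: of_real_minus)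
      (simp add: algebra_simps)
  moreover obtain t where "0 \<le> t" "cinner y (a *v y) = of_real t"
    using nonneg_Reals_cinner[OF assms(1)] by blast
  ultimately have "0 \<le> s * (s * q - 2 * N)" by (metis of_real_eq_iff)
  with s show False by (simp add: zero_le_mult_iff)
qed

text \<open>
  With \<open>D = b - c\<close> the hypothesis gives \<open>b D + D c = 0\<close>, so \<open>D b D\<close> and \<open>D c D\<close> have opposite traces.
  Both are positive, hence both traces and then all diagonal entries vanish. By \<open>mpos_kernel\<close>
  this means \<open>b D = c D = 0\<close>, so that \<open>D D = 0\<close> and \<open>D = 0\<close>.
\<close>

lemma mpos_square_root_unique:
  assumes b: "mpos b" and c: "mpos c" and eq: "b ** b = c ** c"
  shows "b = c"
proof -
  define D where "D = b - c"
  have adj: "madj b = b" "madj c = c" using b c by (simp_all only: mpos_def)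
  have adjD: "madj D = D"
    using adj by (simp add: D_def vec_eq_iff)
  have DbcD: "b ** D + D ** c = 0"
    by (simp add: D_def mult_diff_left mult_diff_right eq)
  have ker: "b *v (D *v x) = 0 \<and> c *v (D *v x) = 0" if x: "x = axis i 1" for x i
  proof -
    have col: "cinner (D *v axis k 1) (a *v (D *v axis k 1)) = (D ** a ** D) $ k $ k" for a k
    proof -
      have "cinner (D *v axis k 1) (a *v (D *v axis k 1)) = cinner (axis k 1) (D *v (a *v (D *v axis k 1)))"
        using cinner_mult_right[of "axis k 1" D] by (simp add: adjD)
      also have "\<dots> = (D ** a ** D) $ k $ k"
        by (simp only: matrix_vector_mul_assoc matrix_mul_assoc cinner_axis_left mult_axis_nth)
      finally show ?thesis .
    qed
    have tr: "trace (D ** b ** D) + trace (D ** c ** D) = 0"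
    proof -
      have "trace (D ** b ** D) + trace (D ** c ** D) = trace (D ** (b ** D)) + trace (D ** (D ** c))"
        using trace_mul_sym[of "D ** c" D] by (simp only: matrix_mul_assoc)
      also have "\<dots> = trace (D ** (b ** D + D ** c))"
        by (simp only: trace_add matrix_add_ldistrib)
      finally show ?thesis by (simp add: DbcD trace_def matrix_mult_nth)
    qed
    define s where "s a k = Re ((D ** a ** D) $ k $ k)" for a k
    have s: "0 \<le> s a k" "(D ** a ** D) $ k $ k = of_real (s a k)" if a: "mpos a" for a k
    proof -
      obtain t where "0 \<le> t" "cinner (D *v axis k 1) (a *v (D *v axis k 1)) = of_real t"
        using nonneg_Reals_cinner[OF a] by blast
      then show "0 \<le> s a k" "(D ** a ** D) $ k $ k = of_real (s a k)" 
        unfolding s_def col by simp_all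
    qed
    have "complex_of_real (sum (s b) UNIV + sum (s c) UNIV) = 0"
      using tr by (simp add: trace_def s b c)
    then have "sum (s b) UNIV + sum (s c) UNIV = 0" by (simp only: of_real_eq_0_iff)
    moreover have "sum (s b) UNIV \<ge> 0" "sum (s c) UNIV \<ge> 0"
      by (simp_all add: sum_nonneg s b c)
    ultimately have "sum (s b) UNIV = 0" "sum (s c) UNIV = 0" by linarith+
    then have "s b i = 0" "s c i = 0"
      by (simp_all add: sum_nonneg_eq_0_iff s b c)
    then have "cinner (D *v x) (b *v (D *v x)) = 0" "cinner (D *v x) (c *v (D *v x)) = 0"
      unfolding x col by (simp_all add: s b c)
    then show ?thesis
      using mpos_kernel b c by blast
  qed
  have "D *v (D *v axis i 1) = 0" for i
    using ker[OF refl, of i] by (simp add: D_def matrix_vector_mult_diff_rdistrib)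
  then have "D *v axis i 1 = 0" for i
    using cinner_mult_right[of "axis i 1" D "D *v axis i 1"]
    by (simp add: adjD cinner_self_eq_0 cinner_axis_left)
  then have "D = 0"
    by (simp add: vec_eq_iff mult_axis_nth)
  then show ?thesis by (simp add: D_def)
qed

lemma mabs_eqI:
  assumes "mpos b" "b ** b = madj a ** a"
  shows "mabs a = b"
  unfolding mabs_def
proof (rule the_equality)
  show "mpos b \<and> b ** b = madj a ** a" using assms by blast
  show "c = b" if "mpos c \<and> c ** c = madj a ** a" for c
    by (rule mpos_square_root_unique) (use that assms in simp_all)
qed

lemma mabs_mpos:
  assumes "mpos a"
  shows "mabs a = a"
proof (rule mabs_eqI[OF assms])
  show "a ** a = madj a ** a" using assms by (simp only: mpos_def)
qed

lemma cmod_1_iff: "cmod c = 1 \<longleftrightarrow> cnj c * c = 1"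
proof -
  have "cnj c * c = of_real ((cmod c)\<^sup>2)"
    using complex_norm_square[of c] by (simp only: mult.commute)
  then have "cnj c * c = 1 \<longleftrightarrow> (cmod c)\<^sup>2 = 1"
    by (simp only: of_real_eq_1_iff)
  moreover have "cmod c \<noteq> - 1" using norm_ge_zero[of c] by linarith
  ultimately show ?thesis by (simp add: power2_eq_1_iff)
qed

section \<open>Absolute values of matrices with one nonzero row\<close>

text \<open>
  If \<open>v\<close> is row \<open>r\<close> of \<open>a\<close>, then \<open>a\<^sup>* a\<close> is the rank one matrix \<open>v\<^sup>* v\<close>, whose square is
  its multiple by the squared length of \<open>v\<close>; dividing by the length of \<open>v\<close> gives the square root. For \<open>v = 0\<close>
  the convention \<open>x / 0 = 0\<close> yields the correct value.
\<close>

lemma mabs_row: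
  assumes "munit r r ** a = a"
  shows "mabs a = (\<chi> i j. cnj (a $ r $ i) * a $ r $ j / of_real (sqrt (\<Sum>k\<in>UNIV. (cmod (a $ r $ k))\<^sup>2)))"
    (is "_ = ?b")
proof (rule mabs_eqI)
  define v where "v k = a $ r $ k" for k
  define S where "S = (\<Sum>k\<in>UNIV. (cmod (v k))\<^sup>2)"
  have S0: "S \<ge> 0" by (simp add: S_def sum_nonneg)
  have b: "?b $ i $ j = cnj (v i) * v j / of_real (sqrt S)" for i j
    by (simp add: v_def S_def)
  have zero: "v i = 0" if "S = 0" for i
    using that by (simp add: S_def sum_nonneg_eq_0_iff)
  have row: "a $ i $ j = (if i = r then v j else 0)" for i j
    using munit_mult_nth[of r r a i j] by (simp add: assms v_def)
  have vv: "(\<Sum>k\<in>UNIV. v k * cnj (v k)) = of_real S"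
    by (simp add: S_def of_real_cmod_square)
  have sq: "complex_of_real (sqrt S) * complex_of_real (sqrt S) = of_real S"
    using S0 by (simp flip: of_real_mult)
  have "(?b ** ?b) $ i $ j = (madj a ** a) $ i $ j" for i j
  proof -
    have "(?b ** ?b) $ i $ j = (\<Sum>k\<in>UNIV. cnj (v i) * v j * (v k * cnj (v k)) / of_real S)"
      unfolding matrix_mult_nth b by (rule sum.cong) (simp_all add: sq mult_ac)
    also have "\<dots> = cnj (v i) * v j * (\<Sum>k\<in>UNIV. v k * cnj (v k)) / of_real S"
      by (simp add: sum_distrib_left sum_divide_distrib)
    also have "\<dots> = cnj (v i) * v j"
      unfolding vv using zero by auto
    also have "\<dots> = (madj a ** a) $ i $ j"
      by (simp add: matrix_mult_nth row if_distrib[of cnj] if_distrib[of "\<lambda>u. u * _"] cong: if_cong)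
    finally show ?thesis .
  qed
  then show "?b ** ?b = madj a ** a" by (simp add: vec_eq_iff)
  have "cinner x (?b *v x) = of_real ((cmod (\<Sum>j\<in>UNIV. v j * x $ j))\<^sup>2 / sqrt S)" for x
  proof -
    have "cinner x (?b *v x) = (\<Sum>i\<in>UNIV. cnj (x $ i) * (\<Sum>j\<in>UNIV. cnj (v i) * v j / of_real (sqrt S) * x $ j))"
      by (simp only: cinner_def matrix_vector_mult_def b) (simp only: vec_lambda_beta)
    also have "\<dots> = (\<Sum>i\<in>UNIV. cnj (v i * x $ i) * (\<Sum>j\<in>UNIV. v j * x $ j) / of_real (sqrt S))"
      by (rule sum.cong) (simp_all add: sum_distrib_left sum_divide_distrib mult_ac)
    also have "\<dots> = (\<Sum>j\<in>UNIV. v j * x $ j) * cnj (\<Sum>i\<in>UNIV. v i * x $ i) / of_real (sqrt S)"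
      by (simp add: sum_distrib_left sum_divide_distrib mult_ac)
    also have "\<dots> = of_real ((cmod (\<Sum>j\<in>UNIV. v j * x $ j))\<^sup>2 / sqrt S)"
      by (simp only: complex_norm_square[symmetric] of_real_divide)
    finally show ?thesis .
  qed
  then have "cinner x (?b *v x) \<in> \<real>\<^sub>\<ge>\<^sub>0" for x
    by (simp only: nonneg_Reals_of_real_iff) (simp add: S0)
  moreover have "madj ?b = ?b" by (simp add: vec_eq_iff mult.commute)
  ultimately show "mpos ?b"
    unfolding mpos_iff by blast
qed

text \<open>The rank one matrix \<open>v\<^sup>* v\<close> determines \<open>v\<close> up to a phase.\<close>

lemma same_phase:
  fixes v w :: "'a \<Rightarrow> complex"
  assumes eq: "\<And>i j. cnj (v i) * v j = cnj (w i) * w j"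
  shows "\<exists>c. cmod c = 1 \<and> (\<forall>j. w j = c * v j)"
proof (cases "\<exists>i. v i \<noteq> 0")
  case True
  then obtain i where i: "v i \<noteq> 0" by blast
  have n: "cmod (v i) = cmod (w i)"
    using arg_cong[OF eq[of i i], of cmod] by (simp add: norm_mult flip: power2_eq_square)
  then have wi: "w i \<noteq> 0" using i by (metis norm_eq_zero)
  have "w j = w i / v i * v j" for j
  proof -
    have "cnj (w i) * (w j * v i) = cnj (v i) * v i * v j"
      using eq[of i j] by (simp add: algebra_simps)
    also have "\<dots> = cnj (w i) * (w i * v j)" using eq[of i i] by simp
    finally show ?thesis using wi i by (simp add: field_simps)
  qed
  moreover have "cmod (w i / v i) = 1" using wi by (simp add: norm_divide n)
  ultimately show ?thesis by blast
next
  case False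
  then have "w j = 0" for j using eq[of j j] by simp
  with False show ?thesis by (intro exI[of _ 1]) auto
qed

lemma mabs_row_eq_imp_phase:
  assumes a: "munit r r ** a = a" and b: "munit r r ** b = b" and eq: "mabs a = mabs b"
  shows "\<exists>c. cmod c = 1 \<and> b = mscale c a"
proof -
  define S where "S x = (\<Sum>k\<in>UNIV. (cmod (x $ r $ k))\<^sup>2)" for x :: "complex ^ 'a ^ 'a"
  have S0: "S x \<ge> 0" for x by (simp add: S_def sum_nonneg)
  have row: "mabs x $ i $ j = cnj (x $ r $ i) * x $ r $ j / of_real (sqrt (S x))"
    if "munit r r ** x = x" for x i j
    by (simp add: mabs_row[OF that] S_def)
  \<comment> \<open>The trace of the absolute value recovers the length of the row, hence the denominator.\<close>
  have tr: "trace (mabs x) = of_real (sqrt (S x))" if "munit r r ** x = x" for x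
  proof -
    have "trace (mabs x) = of_real (S x) / of_real (sqrt (S x))"
      by (simp add: trace_def row[OF that] S_def of_real_cmod_square mult_ac flip: sum_divide_distrib)
    also have "\<dots> = of_real (sqrt (S x))"
      by (metis S0 of_real_divide real_div_sqrt)
    finally show ?thesis .
  qed
  have Seq: "S a = S b"
    using tr[OF a] tr[OF b] eq by simp
  have "cnj (a $ r $ i) * a $ r $ j = cnj (b $ r $ i) * b $ r $ j" for i j
  proof (cases "S a = 0")
    case True
    then show ?thesis using Seq
      by (simp add: S_def sum_nonneg_eq_0_iff)
  next
    case False
    then show ?thesis using row[OF a, of i j] row[OF b, of i j] Seq eq by simp
  qed
  from same_phase[of "\<lambda>j. a $ r $ j" "\<lambda>j. b $ r $ j", OF this]
  obtain c where c: "cmod c = 1" "\<And>j. b $ r $ j = c * a $ r $ j" by blast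
  have "b $ i $ j = c * a $ i $ j" for i j
    using munit_mult_nth[of r r a i j] munit_mult_nth[of r r b i j] c(2) by (simp add: a b)
  then show ?thesis using c(1) by (auto simp: vec_eq_iff)
qed


section \<open>Hilbert modules and their corners\<close>

context hilbert_cstar_module
begin

lemma act_zero_right [simp]: "act a 0 = 0"
  using act_add_right[of a 0 0] by simp

lemma act_zero_left [simp]: "act 0 f = 0"
  using act_add_left[of 0 0 f] by simp

lemma act_diff_left: "act (a - b) f = act a f - act b f"
  using act_add_left[of "a - b" b f] by simp

lemma act_sum_left: "act (\<Sum>i\<in>I. a i) f = (\<Sum>i\<in>I. act (a i) f)"
  by (induction I rule: infinite_finite_induct) (simp_all add: act_add_left)

lemma act_sum_right: "act a (\<Sum>i\<in>I. f i) = (\<Sum>i\<in>I. act a (f i))"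
  by (induction I rule: infinite_finite_induct) (simp_all add: act_add_right)

lemma ip_zero_left [simp]: "ip 0 g = 0"
  using ip_add_left[of 0 0 g] by simp

lemma ip_sum_left: "ip (\<Sum>i\<in>I. f i) g = (\<Sum>i\<in>I. ip (f i) g)"
  by (induction I rule: infinite_finite_induct) (simp_all add: ip_add_left)

lemma ip_add_right: "ip f (g + h) = ip f g + ip f h"
  by (metis ip_adj ip_add_left madj_add)

lemma ip_zero_right [simp]: "ip f 0 = 0"
  using ip_add_right[of f 0 0] by simp

lemma ip_sum_right: "ip f (\<Sum>i\<in>I. g i) = (\<Sum>i\<in>I. ip f (g i))"
  by (induction I rule: infinite_finite_induct) (simp_all add: ip_add_right)

lemma ip_act_right: "ip f (act a g) = ip f g ** madj a"
  by (metis ip_adj ip_act_left madj_mult madj_madj)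

lemma cscale_eq_act: "cscale c f = act (mscale c (mat 1)) f"
  by (simp add: act_mscale act_one)

lemma ip_cscale_left: "ip (cscale c f) g = mscale c (ip f g)"
  by (simp add: cscale_eq_act ip_act_left mscale_mult_left)

lemma ip_cscale_right: "ip f (cscale c g) = mscale (cnj c) (ip f g)"
  by (metis ip_adj ip_cscale_left madj_mscale madj_madj)

lemma ip_diff_left: "ip (f - g) h = ip f h - ip g h"
  using ip_add_left[of "f - g" g h] by simp

lemma ip_diff_right: "ip f (g - h) = ip f g - ip f h"
  using ip_add_right[of f "g - h" h] by simp

text \<open>The equality case of the Cauchy--Schwarz inequality, in which \<open>f - c g\<close> has length zero.\<close>

lemma eq_cscaleI:
  assumes c: "cmod c = 1" and ff: "ip f f = ip g g" and fg: "ip f g = mscale c (ip g g)"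
  shows "f = cscale c g"
proof -
  have cc: "c * cnj c = 1" "cnj c * c = 1" using c by (simp_all add: cmod_1_iff mult.commute)
  have adj: "madj (ip g g) = ip g g" using ip_adj by metis
  have gf: "ip g f = mscale (cnj c) (ip g g)"
    using ip_adj[where f = f and g = g] by (simp only: fg madj_mscale adj)
  have "ip (f - cscale c g) (f - cscale c g) = 0"
    by (simp add: ip_diff_left ip_diff_right ip_cscale_left ip_cscale_right ff fg gf cc)
  then show ?thesis by (simp add: ip_eq_0_iff)
qed

lemma sum_munit_components: "(\<Sum>i\<in>UNIV. act (munit i r) (act (munit r i) f)) = f"
proof -
  have "(\<Sum>i\<in>UNIV. act (munit i r) (act (munit r i) f)) = act (\<Sum>i\<in>UNIV. munit i i) f"
    by (simp add: act_sum_left munit_mult_munit flip: act_mult)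
  then show ?thesis by (simp add: sum_munit act_one)
qed

text \<open>
  The corner is the image of the projection \<open>E\<^sub>r\<^sub>r\<close>; the maps \<open>E\<^sub>r\<^sub>i\<close> send a vector to its
  components in the corner.
\<close>

definition corner :: "'n \<Rightarrow> 'h set" where
  "corner r = {k. act (munit r r) k = k}"

lemma act_munit_in_corner: "act (munit r i) f \<in> corner r"
  by (simp add: corner_def munit_mult_munit flip: act_mult)

lemma add_in_corner: "k \<in> corner r \<Longrightarrow> l \<in> corner r \<Longrightarrow> k + l \<in> corner r"
  by (simp add: corner_def act_add_right)

lemma cscale_in_corner: "k \<in> corner r \<Longrightarrow> cscale c k \<in> corner r"
  by (simp add: corner_def act_cscale)

text \<open>Membership in the corner depends only on \<open>[k, k]\<close>, so maps preserving \<open>[k, k]\<close> respect it.\<close>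

lemma corner_iff_ip: "k \<in> corner r \<longleftrightarrow> (mat 1 - munit r r) ** ip k k ** (mat 1 - munit r r) = 0"
proof -
  have adj: "madj (mat 1 - munit r r) = (mat 1 - munit r r :: complex ^ 'n ^ 'n)"
    by (auto simp: vec_eq_iff munit_nth mat_def)
  have "k \<in> corner r \<longleftrightarrow> act (mat 1 - munit r r) k = 0"
    by (auto simp: corner_def act_diff_left act_one)
  then show ?thesis
    by (simp add: ip_act_left ip_act_right adj matrix_mul_assoc flip: ip_eq_0_iff)
qed

end

section \<open>Maps preserving the absolute value of the inner product\<close>

locale abs_ip_preserver = hilbert_cstar_module cscale act ip
  for cscale :: "complex \<Rightarrow> 'h::ab_group_add \<Rightarrow> 'h"
    and act :: "complex ^ 'n ^ 'n \<Rightarrow> 'h \<Rightarrow> 'h"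
    and ip :: "'h \<Rightarrow> 'h \<Rightarrow> complex ^ 'n ^ 'n" +
  fixes T :: "'h \<Rightarrow> 'h"
  assumes mabs_ip_T: "mabs (ip (T f) (T g)) = mabs (ip f g)"
begin

lemma ip_T_T: "ip (T f) (T f) = ip f f"
  using mabs_ip_T[of f f] by (simp add: mabs_mpos ip_pos)

lemma T_in_corner: "T k \<in> corner r \<longleftrightarrow> k \<in> corner r"
  by (simp add: corner_iff_ip ip_T_T)

text \<open>
  The phase \<open>c\<close> multiplies the whole matrix, so all components of \<open>f\<close> are tested against \<open>k\<close>
  with the same phase. This simultaneity is what makes \<open>T\<close> linear rather than antilinear.
\<close>

lemma ip_T_corner:
  assumes "k \<in> corner r"
  shows "\<exists>c. cmod c = 1 \<and> ip (T f) (T k) = mscale c (ip f k)"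
proof -
  have row: "munit r r ** ip l g = ip l g" if "l \<in> corner r" for l g
    using that ip_act_left[of "munit r r" l g] by (simp add: corner_def)
  obtain c where c: "cmod c = 1" "ip (T k) (T f) = mscale c (ip k f)"
    using mabs_row_eq_imp_phase[of r "ip k f" "ip (T k) (T f)"] row assms T_in_corner mabs_ip_T by metis
  have "ip (T f) (T k) = mscale (cnj c) (ip f k)"
    using c(2) ip_adj madj_mscale by metis
  with c(1) show ?thesis by (intro exI[of _ "cnj c"]) simp
qed

lemma T_act_corner:
  assumes "act a f \<in> corner r"
  shows "\<exists>c. cmod c = 1 \<and> T (act a f) = cscale c (act a (T f))"
proof -
  let ?k = "act a f"
  obtain c where c: "cmod c = 1" "ip (T f) (T ?k) = mscale c (ip f ?k)"
    using ip_T_corner[OF assms] by blast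
  have g: "ip (act a (T f)) (act a (T f)) = ip ?k ?k"
    by (simp add: ip_act_left ip_act_right ip_T_T)
  have "ip (act a (T f)) (T ?k) = mscale c (ip ?k ?k)"
    by (simp add: ip_act_left c(2) mscale_mult_right)
  then have "act a (T f) = cscale c (T ?k)"
    by (intro eq_cscaleI c(1)) (simp_all add: g ip_T_T)
  moreover have "cnj c * c = 1" using c(1) by (simp add: cmod_1_iff)
  ultimately have "T ?k = cscale (cnj c) (act a (T f))" by simp
  then show ?thesis using c(1) by (intro exI[of _ "cnj c"]) simp
qed

end

section \<open>A linear lift on the corner\<close>

text \<open>The reference vector \<open>e\<close> fixes the phases; \<open>s\<close> is the slot for a second component.\<close>

locale wigner_frame = abs_ip_preserver cscale act ip T
  for cscale :: "complex \<Rightarrow> 'h::ab_group_add \<Rightarrow> 'h"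
    and act :: "complex ^ 'n ^ 'n \<Rightarrow> 'h \<Rightarrow> 'h"
    and ip :: "'h \<Rightarrow> 'h \<Rightarrow> complex ^ 'n ^ 'n"
    and T :: "'h \<Rightarrow> 'h" +
  fixes r s :: 'n and e :: 'h
  assumes distinct: "r \<noteq> s" and e_corner: "e \<in> corner r" and e_nonzero: "e \<noteq> 0"
begin

text \<open>The condition on \<open>ip w (T e)\<close> selects one phase whenever \<open>q\<close> is not orthogonal to \<open>e\<close>.\<close>

definition lifts :: "'h \<Rightarrow> 'h \<Rightarrow> bool" where
  "lifts q w \<longleftrightarrow> ip w w = ip q q \<and> ip w (T e) = ip q e \<and> (\<exists>c. cmod c = 1 \<and> T q = cscale c w)"

lemma ip_e_e: "ip e e \<noteq> 0"
  using e_nonzero by (simp add: ip_eq_0_iff)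

lemma lifts_unique:
  assumes w: "lifts q w" and w': "lifts q w'" and q: "ip q e \<noteq> 0"
  shows "w = w'"
proof -
  obtain c c' where c: "cmod c = 1" "T q = cscale c w" and c': "cmod c' = 1" "T q = cscale c' w'"
    using w w' by (auto simp: lifts_def)
  have "mscale c (ip q e) = ip (T q) (T e)"
    using w by (simp add: c(2) ip_cscale_left lifts_def)
  also have "\<dots> = mscale c' (ip q e)"
    using w' by (simp add: c'(2) ip_cscale_left lifts_def)
  finally have "c = c'" using q by simp
  then show ?thesis using c c' by auto
qed

lemma lifts_e: "lifts e (T e)"
  by (auto simp: lifts_def ip_T_T intro!: exI[of _ 1])

text \<open>
  The vector \<open>f\<close> with components \<open>k\<close> and \<open>l\<close> yields every combination of \<open>k\<close> and \<open>l\<close> as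
  \<open>a f\<close>, and \<open>a g\<close> depends linearly on \<open>a\<close>, where \<open>g\<close> is \<open>T f\<close> with its phase normalized.
\<close>

lemma lifts_pair:
  assumes k: "k \<in> corner r" and l: "l \<in> corner r"
  shows "\<exists>v w. \<forall>x y. lifts (cscale x k + cscale y l) (cscale x v + cscale y w)"
proof -
  define f where "f = k + act (munit s r) l"
  have fk: "act (munit r r) f = k" and fl: "act (munit r s) f = l"
  proof -
    have "act (munit r s) k = 0" 
      using k distinct by (simp add: corner_def) (metis act_mult act_zero_left munit_mult_munit)
    then show "act (munit r r) f = k" "act (munit r s) f = l"
      using k l distinct by (simp_all add: f_def act_add_right munit_mult_munit corner_def flip: act_mult)
  qed
  obtain c where c: "cmod c = 1" "ip (T f) (T e) = mscale c (ip f e)"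
    using ip_T_corner[OF e_corner] by blast
  have cc: "cnj c * c = 1" "c * cnj c = 1" using c(1) by (simp_all add: cmod_1_iff mult.commute)
  define g where "g = cscale (cnj c) (T f)"
  define b where "b x y = mscale x (munit r r) + mscale y (munit r s)" for x y
  have q: "act (b x y) f = cscale x k + cscale y l" for x y
    by (simp add: b_def act_add_left act_mscale fk fl)
  have w: "act (b x y) g = cscale x (act (munit r r) g) + cscale y (act (munit r s) g)" for x y
    by (simp add: b_def act_add_left act_mscale)
  have "lifts (act (b x y) f) (act (b x y) g)" for x y
  proof -
    have "act (b x y) f \<in> corner r"
      unfolding q by (intro add_in_corner cscale_in_corner k l)
    then obtain d where d: "cmod d = 1" "T (act (b x y) f) = cscale d (act (b x y) (T f))"
      using T_act_corner by blast
    have "T (act (b x y) f) = cscale (d * c) (act (b x y) g)"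
      by (simp add: d g_def act_cscale cc mult.assoc)
    moreover have "cmod (d * c) = 1" using c d by (simp add: norm_mult)
    ultimately show ?thesis
      unfolding lifts_def
      by (auto simp: g_def ip_act_left ip_act_right ip_cscale_left ip_cscale_right ip_T_T
          mscale_mult_left mscale_mult_right c cc)
  qed
  then show ?thesis unfolding q w by blast
qed

lemma lifts_with_e:
  assumes "k \<in> corner r"
  shows "\<exists>v. \<forall>x y. lifts (cscale x k + cscale y e) (cscale x v + cscale y (T e))"
proof -
  obtain v w where vw: "\<And>x y. lifts (cscale x k + cscale y e) (cscale x v + cscale y w)"
    using lifts_pair[OF assms e_corner] by blast
  have "lifts e w" using vw[of 0 1] by simp
  then have "w = T e" using lifts_unique lifts_e ip_e_e by blast
  then show ?thesis using vw by blast
qed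

text \<open>
  Demanding lifts along all combinations with \<open>e\<close>, rather than a lift of \<open>k\<close> alone, pins down
  the value also when \<open>k\<close> is orthogonal to \<open>e\<close>.
\<close>

definition V :: "'h \<Rightarrow> 'h" where
  "V k = (SOME v. \<forall>x y. lifts (cscale x k + cscale y e) (cscale x v + cscale y (T e)))"

lemma lifts_V:
  "k \<in> corner r \<Longrightarrow> lifts (cscale x k + cscale y e) (cscale x (V k) + cscale y (T e))"
  unfolding V_def using someI_ex[OF lifts_with_e] by blast

lemma lifts_V1: "k \<in> corner r \<Longrightarrow> lifts (k + cscale y e) (V k + cscale y (T e))"
  using lifts_V[of k 1 y] by simp

text \<open>
  All but finitely many multiples of \<open>e\<close> move \<open>k\<close> to a vector that is not orthogonal to \<open>e\<close>, so
  finitely many such conditions can be met at once.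
\<close>

lemma finite_orthogonal:
  assumes "a \<noteq> 0"
  shows "finite {t. ip (k + cscale (a * t) e) e = 0}" (is "finite ?S")
proof -
  have S: "mscale (a * t) (ip e e) = - ip k e" if "t \<in> ?S" for t
    using that by (simp add: ip_add_left ip_cscale_left eq_neg_iff_add_eq_0 add.commute)
  have "u = t" if u: "u \<in> ?S" and t: "t \<in> ?S" for u t
  proof -
    have "mscale (a * u) (ip e e) = mscale (a * t) (ip e e)"
      using S[OF u] S[OF t] by simp
    then show ?thesis using assms ip_e_e by simp
  qed
  then show ?thesis by (metis (no_types, lifting) finite.simps is_singletonI' is_singleton_def)
qed

lemma V_cscale:
  assumes k: "k \<in> corner r"
  shows "V (cscale x k) = cscale x (V k)"
proof -
  have "finite {t. ip (cscale x k + cscale (1 * t) e) e = 0}" by (rule finite_orthogonal) simp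
  then obtain t where t: "ip (cscale x k + cscale t e) e \<noteq> 0"
    using ex_new_if_finite[OF infinite_UNIV_char_0[where 'a = complex]] by auto
  have "V (cscale x k) + cscale t (T e) = cscale x (V k) + cscale t (T e)"
    using lifts_unique[OF lifts_V1[OF cscale_in_corner[OF k]] lifts_V[OF k] t] .
  then show ?thesis by simp
qed

lemma V_add:
  assumes k: "k \<in> corner r" and l: "l \<in> corner r"
  shows "V (k + l) = V k + V l"
proof -
  have "finite ({t. ip (k + cscale (1 * t) e) e = 0} \<union> {t. ip (l + cscale (1 * t) e) e = 0}
      \<union> {t. ip (k + l + cscale (2 * t) e) e = 0})" (is "finite ?S")
    by (intro finite_UnI finite_orthogonal) simp_all
  from ex_new_if_finite[OF infinite_UNIV_char_0 this] obtain t where "t \<notin> ?S" by blast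
  then have t: "ip (k + cscale t e) e \<noteq> 0" "ip (l + cscale t e) e \<noteq> 0"
    "ip (k + l + cscale (2 * t) e) e \<noteq> 0"
    by simp_all
  have te: "k + cscale t e \<in> corner r" "l + cscale t e \<in> corner r"
    by (simp_all add: k l e_corner add_in_corner cscale_in_corner)
  obtain v w where vw: "\<And>x y. lifts (cscale x (k + cscale t e) + cscale y (l + cscale t e)) (cscale x v + cscale y w)"
    using lifts_pair[OF te] by blast
  have "v = V k + cscale t (T e)"
    using lifts_unique[OF _ lifts_V1[OF k] t(1)] vw[of 1 0] by simp
  moreover have "w = V l + cscale t (T e)"
    using lifts_unique[OF _ lifts_V1[OF l] t(2)] vw[of 0 1] by simp
  moreover have double: "cscale (2 * t) x = cscale t x + cscale t x" for x
    by (simp only: mult_2 scale_left_distrib)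
  have "k + cscale t e + (l + cscale t e) = k + l + cscale (2 * t) e"
    by (simp add: double add_ac)
  with vw[of 1 1] have "lifts (k + l + cscale (2 * t) e) (v + w)" by simp
  then have "v + w = V (k + l) + cscale (2 * t) (T e)"
    by (rule lifts_unique[OF _ lifts_V1[OF add_in_corner[OF k l]] t(3)])
  ultimately show ?thesis
    by (simp add: double add_ac)
qed

lemma ip_V_self: "k \<in> corner r \<Longrightarrow> ip (V k) (V k) = ip k k"
  using lifts_V1[of k 0] by (simp add: lifts_def)

lemma T_eq_V: "k \<in> corner r \<Longrightarrow> \<exists>c. cmod c = 1 \<and> T k = cscale c (V k)"
  using lifts_V1[of k 0] by (simp add: lifts_def)

text \<open>Polarization, carried out with the matrix valued form \<open>D\<close>.\<close>

lemma ip_V: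
  assumes k: "k \<in> corner r" and l: "l \<in> corner r"
  shows "ip (V k) (V l) = ip k l"
proof -
  define D where "D k l = ip (V k) (V l) - ip k l" for k l
  have sym: "D k m + D m k = 0" if m: "m \<in> corner r" for m
    using ip_V_self[OF add_in_corner[OF k m]]
    by (simp add: D_def V_add k m ip_add_left ip_add_right ip_V_self algebra_simps)
  have "D k (cscale \<i> l) = mscale (- \<i>) (D k l)" "D (cscale \<i> l) k = mscale \<i> (D l k)"
    by (simp_all add: D_def V_cscale l ip_cscale_left ip_cscale_right mscale.scale_right_diff_distrib)
  then have "mscale (- \<i>) (D k l) + mscale \<i> (D l k) = 0"
    using sym[OF cscale_in_corner[OF l, of \<i>]] by simp
  then have "mscale \<i> (D l k - D k l) = 0"
    by (simp add: mscale.scale_right_diff_distrib)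
  then have "D l k = D k l" by simp
  then have "mscale 2 (D k l) = 0"
    using sym[OF l] by (simp add: vec_eq_iff)
  then show ?thesis by (simp add: D_def)
qed

lemma V_0: "V 0 = 0"
  using V_cscale[OF e_corner, of 0] by simp

lemma V_sum:
  assumes "finite I" "\<And>i. k i \<in> corner r"
  shows "(\<Sum>i\<in>I. k i) \<in> corner r \<and> V (\<Sum>i\<in>I. k i) = (\<Sum>i\<in>I. V (k i))"
  using assms(1)
proof (induction I rule: finite_induct)
  case empty
  show ?case by (simp add: V_0 corner_def)
next
  case (insert i I)
  then show ?case using assms(2)[of i] by (simp add: V_add add_in_corner)
qed

section \<open>Extension to the whole module\<close>

definition U :: "'h \<Rightarrow> 'h" where
  "U f = (\<Sum>i\<in>UNIV. act (munit i r) (V (act (munit r i) f)))"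

text \<open>
  Left multiplication by \<open>a\<close> forms linear combinations of the components, and \<open>V\<close> is linear.
\<close>

lemma U_act: "U (act a f) = act a (U f)"
proof -
  have "V (act (munit r i) (act a f)) = (\<Sum>j\<in>UNIV. cscale (a $ i $ j) (V (act (munit r j) f)))" for i
  proof -
    have "act (munit r i) (act a f) = (\<Sum>j\<in>UNIV. cscale (a $ i $ j) (act (munit r j) f))"
      by (simp add: munit_mult_expand act_sum_left act_mscale flip: act_mult)
    moreover have "V \<dots> = (\<Sum>j\<in>UNIV. V (cscale (a $ i $ j) (act (munit r j) f)))"
      by (simp add: V_sum cscale_in_corner act_munit_in_corner)
    ultimately show ?thesis by (simp add: V_cscale act_munit_in_corner)
  qed
  then have "U (act a f) = (\<Sum>i\<in>UNIV. \<Sum>j\<in>UNIV. cscale (a $ i $ j) (act (munit i r) (V (act (munit r j) f))))"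
    by (simp add: U_def act_sum_right act_cscale)
  also have "\<dots> = (\<Sum>j\<in>UNIV. \<Sum>i\<in>UNIV. cscale (a $ i $ j) (act (munit i r) (V (act (munit r j) f))))"
    by (rule sum.swap)
  also have "\<dots> = (\<Sum>j\<in>UNIV. act (a ** munit j r) (V (act (munit r j) f)))"
    by (simp add: mult_munit_expand act_sum_left act_mscale)
  also have "\<dots> = act a (U f)"
    by (simp add: U_def act_sum_right act_mult)
  finally show ?thesis .
qed

lemma U_add: "U (f + g) = U f + U g"
  by (simp add: U_def act_add_right V_add act_munit_in_corner sum.distrib)

lemma U_cscale: "U (cscale c f) = cscale c (U f)"
  by (simp add: cscale_eq_act U_act)

lemma ip_U: "ip (U f) (U g) = ip f g"
proof -
  have "ip (U f) (U g) = (\<Sum>i\<in>UNIV. \<Sum>j\<in>UNIV. 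
      ip (act (munit i r) (act (munit r i) f)) (act (munit j r) (act (munit r j) g)))"
    unfolding U_def ip_sum_left
    by (rule sum.cong[OF refl], unfold ip_sum_right, rule sum.cong[OF refl])
      (simp only: ip_act_left[of "munit _ r"] ip_act_right[of _ "munit _ r"] ip_V act_munit_in_corner)
  also have "\<dots> = ip f g"
    by (simp only: sum_munit_components flip: ip_sum_left ip_sum_right)
  finally show ?thesis .
qed

lemma A_isometry_U: "A_isometry cscale act ip U"
  unfolding A_isometry_def
  using vector_space_axioms
  by (simp add: U_act ip_U Vector_Spaces.linear_iff U_add U_cscale)

text \<open>If \<open>k\<close> and \<open>l\<close> are orthogonal, \<open>k + l\<close> serves, and otherwise \<open>k\<close> itself.\<close>

lemma common_test_vector:
  assumes "k \<noteq> 0" "l \<noteq> 0" "k \<in> corner r" "l \<in> corner r"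
  shows "\<exists>b \<in> corner r. ip k b \<noteq> 0 \<and> ip l b \<noteq> 0"
proof (cases "ip k l = 0")
  case True
  moreover have "ip l k = 0" using ip_adj[where f = k and g = l] True by (simp add: vec_eq_iff)
  ultimately show ?thesis using assms
    by (intro bexI[of _ "k + l"]) (simp_all add: ip_add_right ip_eq_0_iff add_in_corner)
next
  case False
  moreover have "ip l k \<noteq> 0" using ip_adj[where f = l and g = k] False by (auto simp: vec_eq_iff)
  ultimately show ?thesis using assms by (auto simp: ip_eq_0_iff)
qed

text \<open>
  Each component of \<open>T f\<close> is a phase times the component of \<open>U f\<close>. Against a test vector \<open>b\<close>, the
  single phase of \<open>ip_T_corner\<close> governs all components, which forces their phases to agree.
\<close>

lemma T_eq_U: "\<exists>c. cmod c = 1 \<and> T f = cscale c (U f)"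
proof -
  define k where "k i = act (munit r i) f" for i
  have kc: "k i \<in> corner r" for i by (simp add: k_def act_munit_in_corner)
  have ex: "\<exists>c. cmod c = 1 \<and> act (munit r i) (T f) = cscale c (V (k i))" for i
  proof -
    obtain c where c: "cmod c = 1" "T (k i) = cscale c (act (munit r i) (T f))"
      using T_act_corner[of "munit r i" f r] kc unfolding k_def by blast
    obtain d where d: "cmod d = 1" "T (k i) = cscale d (V (k i))" using T_eq_V kc by blast
    have "act (munit r i) (T f) = cscale (cnj c * c) (act (munit r i) (T f))"
      using c(1) by (simp add: cmod_1_iff)
    also have "\<dots> = cscale (cnj c * d) (V (k i))"
      using c(2) d(2) by (metis scale_scale)
    finally show ?thesis using c(1) d(1) by (intro exI[of _ "cnj c * d"]) (simp add: norm_mult)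
  qed
  then obtain c where c: "\<And>i. cmod (c i) = 1" "\<And>i. act (munit r i) (T f) = cscale (c i) (V (k i))"
    by metis
  have same: "c i = c j" if nonzero: "k i \<noteq> 0" "k j \<noteq> 0" for i j
  proof -
    obtain b where b: "b \<in> corner r" "ip (k i) b \<noteq> 0" "ip (k j) b \<noteq> 0"
      using common_test_vector[OF nonzero kc kc] by blast
    obtain a where a: "ip (T f) (T b) = mscale a (ip f b)" using ip_T_corner[OF b(1)] by blast
    obtain d where d: "cmod d = 1" "T b = cscale d (V b)" using T_eq_V b(1) by blast
    have "c m * cnj d = a" if m: "ip (k m) b \<noteq> 0" for m
    proof -
      have "mscale a (ip (k m) b) = ip (act (munit r m) (T f)) (T b)"
        by (simp add: k_def ip_act_left a mscale_mult_right)
      also have "\<dots> = mscale (c m * cnj d) (ip (k m) b)"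
        by (simp add: c(2) d(2) ip_cscale_left ip_cscale_right ip_V kc b(1))
      finally show ?thesis using m by simp
    qed
    from this[OF b(2)] this[OF b(3)] have "c i * cnj d = c j * cnj d" by simp
    then show ?thesis using d(1) by auto
  qed
  have "\<exists>a. cmod a = 1 \<and> (\<forall>i. k i \<noteq> 0 \<longrightarrow> c i = a)"
  proof (cases "\<exists>i. k i \<noteq> 0")
    case True
    then show ?thesis using same c(1) by metis
  next
    case False
    then show ?thesis by (intro exI[of _ 1]) simp
  qed
  then obtain a where a: "cmod a = 1" "\<And>i. k i \<noteq> 0 \<Longrightarrow> c i = a" by blast
  have "act (munit r i) (T f) = cscale a (V (k i))" for i
    using c(2) a(2) V_0 by (cases "k i = 0") simp_all
  then have "(\<Sum>i\<in>UNIV. act (munit i r) (act (munit r i) (T f))) = cscale a (U f)"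
    by (simp add: U_def k_def act_cscale scale_sum_right)
  then show ?thesis using a(1) by (auto simp: sum_munit_components)
qed

end

theorem mainTheorem1:
  fixes cscale :: "complex \<Rightarrow> 'h::ab_group_add \<Rightarrow> 'h"
    and act :: "complex ^ 'n ^ 'n \<Rightarrow> 'h \<Rightarrow> 'h"
    and ip :: "'h \<Rightarrow> 'h \<Rightarrow> complex ^ 'n ^ 'n"
    and T :: "'h \<Rightarrow> 'h"
  assumes "CARD('n) > 1"
    and "hilbert_cstar_module cscale act ip"
    and "\<And>f f'. mabs (ip (T f) (T f')) = mabs (ip f f')"
  shows "\<exists>U \<phi>. A_isometry cscale act ip U \<and> phase_function \<phi> \<and>
           (\<forall>f. T f = cscale (\<phi> f) (U f))"
proof -
  interpret hilbert_cstar_module cscale act ip by (fact assms(2))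
  interpret abs_ip_preserver cscale act ip T
    by unfold_locales (fact assms(3))
  obtain r :: 'n where True by blast
  obtain s :: 'n where "r \<noteq> s"
    using assms(1) by (metis (full_types) UNIV_I card_1_singleton_iff less_irrefl UNIV_eq_I singleton_iff One_nat_def)
  \<comment> \<open>A zero corner leaves no reference vector, but then the module itself is zero.\<close>
  show ?thesis
  proof (cases "\<exists>e. e \<in> corner r \<and> e \<noteq> 0")
    case True
    then obtain e where "e \<in> corner r" "e \<noteq> 0" by blast
    then interpret wigner_frame cscale act ip T r s e
      using \<open>r \<noteq> s\<close> by unfold_locales
    obtain \<phi> where "\<forall>f. cmod (\<phi> f) = 1 \<and> T f = cscale (\<phi> f) (U f)"
      using T_eq_U by metis
    then show ?thesis using A_isometry_U unfolding phase_function_def by blast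
  next
    case False
    then have "act (munit r i) f = 0" for i f
      using act_munit_in_corner by blast
    then have zero: "f = 0" for f :: 'h
      using sum_munit_components[of r f] by simp
    have "A_isometry cscale act ip id"
      unfolding A_isometry_def by (simp add: linear_id)
    moreover have "phase_function (\<lambda>_::'h. 1)" by (simp add: phase_function_def)
    moreover have "T f = cscale 1 (id f)" for f
      using zero[of "T f"] zero[of f] by simp
    ultimately show ?thesis by blast
  qed
qed

end
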